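(* Let $G$ be a biautomatic group, $L_1$ be an automatic structure for $\pi_1:A^*\to G$, $L_2$ be a biautomatic structure for $\pi_2:B^*\to G$ admitting a departure function, and $\varphi\in\mathrm{End}(G)$. If the BRP holds for $(\varphi,L_1,L_2)$, then so does the FT-BRP.
   Context: Maps are written on the right. Let $A$ be a finite alphabet and $\pi:A^*\to G$ a surjective (monoid) homomorphism onto a group $G$. $d_A$ denotes the geodesic (word) metric on the Cayley graph $\Gamma_A(G)$ of $G$ with respect to $A\pi$. For a word $u$, $u^{[n]}$ is its prefix with $n$ letters, and $u^{[n]}=u$ if $n>|u|$. $u\diamond v$ is the unique word over $(A\times A)\cup(A\times\{\$\})\cup(\{\$\}\times A)$ whose projection to the first (resp. second) component lies in $u\$^*$ (resp. $v\$^*$). An automatic structure for $\pi$ is a rational language $L\subseteq A^*$ with $L\pi=G$ such that for each $x\in A\cup\{1\}$ the language $\{u\diamond v\mid u,v\in L, v\pi=(ux)\pi\}$ is recognized by a finite state automaton; it is biautomatic if in addition each $\{u\diamond v\mid u,v\in L, v\pi=(xu)\pi\}$ is recognized by a finite state automaton. (Equivalently: rational sections satisfying the fellow traveller property, respectively its variant in which paths labelled by words of $L$ may also start at distance at most one.) A group is biautomatic if it has a biautomatic structure. A departure function for $(G,L)$ is a function $D:\mathbb R_{\ge0}\to\mathbb R_{\ge 0}$ such that if $w\in L$, $r,s\ge0$, $t\ge D(r)$ and $s+t\le|w|$, then $d_A(w^{[s]}\pi,w^{[s+t]}\pi)>r$ (with $s,t$ integers). Words $u,v\in A^*$ $p$-fellow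 travel in $\Gamma_A(G)$ if $d_A(u^{[n]}\pi,v^{[n]}\pi)\le p$ for all $n\in\mathbb N$; they are $p$-MFT (meeting fellow travellers) if moreover $u\pi=v\pi$. FT-BRP: the FT-BRP holds for $(\varphi,L_1,L_2)$ if for every $p\ge 0$ there is $q\ge0$ such that: whenever $u_i\in L_1$ and $u_i'\in L_2$ with $u_i'\pi_2=u_i\pi_1\varphi$ for $i=1,2,3$, if $u_1u_2$ and $u_3$ are $p$-MFT in $\Gamma_A(G)$, then $u_1'u_2'$ and $u_3'$ are $q$-MFT in $\Gamma_B(G)$. BRP: for a word $u$ and $x\in G$ let $\theta_u^x:\{0,\dots,|u|\}\to G$, $n\mapsto x(u^{[n]}\pi)$ ($\pi$ the relevant homomorphism). The BRP holds for $(\varphi,L_1,L_2)$ if there is $N>0$ such that $\mathrm{Haus}(\mathrm{Im}(\theta_\alpha^x\varphi),\mathrm{Im}(\theta_\beta^{x\varphi}))\le N$ for all $x\in G$, $\alpha\in L_1$, $\beta\in L_2$ with $\beta\pi_2=\alpha\pi_1\varphi$, where $\mathrm{Haus}$ is Hausdorff distance with respect to a word metric of a finite generating set (the choice is irrelevant). *)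

theory Defs
  imports Complex_Main "HOL-Library.Extended_Real" "HOL-Algebra.Generated_Groups"
begin

text \<open>Words over an alphabet \<open>A\<close> are the elements of \<open>lists A\<close>; \<open>concat ` lists K\<close> below is
  the Kleene star of \<open>K\<close>.\<close>

inductive rational :: "'a set \<Rightarrow> 'a list set \<Rightarrow> bool" for A :: "'a set" where
  finite: "finite K \<Longrightarrow> K \<subseteq> lists A \<Longrightarrow> rational A K"
| union: "rational A K \<Longrightarrow> rational A L \<Longrightarrow> rational A (K \<union> L)"
| conc: "rational A K \<Longrightarrow> rational A L \<Longrightarrow> rational A {u @ v | u v. u \<in> K \<and> v \<in> L}"
| star: "rational A K \<Longrightarrow> rational A (concat ` lists K)"

record ('q, 'x) fsa =
  states :: "'q set"
  initials :: "'q set"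
  finals :: "'q set"
  trans :: "('q \<times> 'x \<times> 'q) set"

definition fsa_over :: "'x set \<Rightarrow> ('q, 'x) fsa \<Rightarrow> bool" where
  "fsa_over X M \<longleftrightarrow> finite (states M) \<and> initials M \<subseteq> states M \<and> finals M \<subseteq> states M
     \<and> trans M \<subseteq> states M \<times> X \<times> states M"

fun fsa_path :: "('q \<times> 'x \<times> 'q) set \<Rightarrow> 'q \<Rightarrow> 'x list \<Rightarrow> 'q \<Rightarrow> bool" where
  "fsa_path T p [] q \<longleftrightarrow> p = q"
| "fsa_path T p (x # w) q \<longleftrightarrow> (\<exists>r. (p, x, r) \<in> T \<and> fsa_path T r w q)"

definition fsa_language :: "('q, 'x) fsa \<Rightarrow> 'x list set" where
  "fsa_language M = {w. \<exists>p\<in>initials M. \<exists>q\<in>finals M. fsa_path (trans M) p w q}"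

text \<open>Taking natural numbers as states is no restriction, since state sets are finite.\<close>

definition fsa_recognized :: "'x set \<Rightarrow> 'x list set \<Rightarrow> bool" where
  "fsa_recognized X K \<longleftrightarrow> (\<exists>M :: (nat, 'x) fsa. fsa_over X M \<and> fsa_language M = K)"

text \<open>The padding symbol is \<open>None\<close>, a letter \<open>a\<close> is \<open>Some a\<close>.\<close>

definition padded_alphabet :: "'a set \<Rightarrow> ('a option \<times> 'a option) set" where
  "padded_alphabet A = Some ` A \<times> Some ` A \<union> Some ` A \<times> {None} \<union> {None} \<times> Some ` A"

fun diamond :: "'a list \<Rightarrow> 'a list \<Rightarrow> ('a option \<times> 'a option) list" (infix "\<diamondop>" 64) where
  "[] \<diamondop> [] = []"
| "(a # u) \<diamondop> [] = (Some a, None) # (u \<diamondop> [])"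
| "[] \<diamondop> (b # v) = (None, Some b) # ([] \<diamondop> v)"
| "(a # u) \<diamondop> (b # v) = (Some a, Some b) # (u \<diamondop> v)"

lemma diamond_unique:
  assumes "u \<in> lists A" "v \<in> lists A"
  shows "w = u \<diamondop> v \<longleftrightarrow> w \<in> lists (padded_alphabet A)
    \<and> (\<exists>m. map fst w = map Some u @ replicate m None)
    \<and> (\<exists>n. map snd w = map Some v @ replicate n None)"
  using assms
proof (induction u v arbitrary: w rule: diamond.induct)
  case 1
  show ?case
    by (cases w) (auto simp: padded_alphabet_def Cons_replicate_eq)
next
  case (2 a u)
  show ?case
    using 2 by (cases w) (auto simp: padded_alphabet_def Cons_replicate_eq)
next
  case (3 b v)
  show ?case
    using 3 by (cases w) (auto simp: padded_alphabet_def Cons_replicate_eq)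
next
  case (4 a u b v)
  show ?case
    using 4 by (cases w) (auto simp: padded_alphabet_def)
qed

definition surj_monoid_hom :: "'a set \<Rightarrow> ('a list \<Rightarrow> 'g) \<Rightarrow> ('g, 'm) monoid_scheme \<Rightarrow> bool" where
  "surj_monoid_hom A \<pi> G \<longleftrightarrow>
     \<pi> [] = \<one>\<^bsub>G\<^esub>
     \<and> (\<forall>u\<in>lists A. \<forall>v\<in>lists A. \<pi> (u @ v) = \<pi> u \<otimes>\<^bsub>G\<^esub> \<pi> v)
     \<and> \<pi> ` lists A = carrier G"

text \<open>The geodesic metric treats the edges of the Cayley graph as undirected, so the generating
  set need not be closed under inverses.\<close>

definition cayley_adj :: "('g, 'm) monoid_scheme \<Rightarrow> 'g set \<Rightarrow> ('g \<times> 'g) set" where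
  "cayley_adj G S = {(g, h). g \<in> carrier G \<and> h \<in> carrier G
     \<and> (\<exists>s\<in>S. h = g \<otimes>\<^bsub>G\<^esub> s \<or> g = h \<otimes>\<^bsub>G\<^esub> s)}"

definition word_dist :: "('g, 'm) monoid_scheme \<Rightarrow> 'g set \<Rightarrow> 'g \<Rightarrow> 'g \<Rightarrow> nat" where
  "word_dist G S g h = (LEAST n. (g, h) \<in> cayley_adj G S ^^ n)"

definition alphabet_dist ::
    "('g, 'm) monoid_scheme \<Rightarrow> 'a set \<Rightarrow> ('a list \<Rightarrow> 'g) \<Rightarrow> 'g \<Rightarrow> 'g \<Rightarrow> nat" where
  "alphabet_dist G A \<pi> = word_dist G ((\<lambda>a. \<pi> [a]) ` A)"

definition automatic_structure ::
    "('g, 'm) monoid_scheme \<Rightarrow> 'a set \<Rightarrow> ('a list \<Rightarrow> 'g) \<Rightarrow> 'a list set \<Rightarrow> bool" where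
  "automatic_structure G A \<pi> L \<longleftrightarrow>
     rational A L \<and> L \<subseteq> lists A \<and> \<pi> ` L = carrier G
     \<and> (\<forall>x \<in> insert [] {[a] | a. a \<in> A}.
          fsa_recognized (padded_alphabet A) {u \<diamondop> v | u v. u \<in> L \<and> v \<in> L \<and> \<pi> v = \<pi> (u @ x)})"

definition biautomatic_structure ::
    "('g, 'm) monoid_scheme \<Rightarrow> 'a set \<Rightarrow> ('a list \<Rightarrow> 'g) \<Rightarrow> 'a list set \<Rightarrow> bool" where
  "biautomatic_structure G A \<pi> L \<longleftrightarrow>
     automatic_structure G A \<pi> L
     \<and> (\<forall>x \<in> insert [] {[a] | a. a \<in> A}.
          fsa_recognized (padded_alphabet A) {u \<diamondop> v | u v. u \<in> L \<and> v \<in> L \<and> \<pi> v = \<pi> (x @ u)})"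

text \<open>Every finite alphabet can be renamed to a finite set of natural numbers.\<close>

definition biautomatic_group :: "('g, 'm) monoid_scheme \<Rightarrow> bool" where
  "biautomatic_group G \<longleftrightarrow> group G \<and>
     (\<exists>(A :: nat set) \<pi> L. finite A \<and> surj_monoid_hom A \<pi> G \<and> biautomatic_structure G A \<pi> L)"

definition departure_function ::
    "('g, 'm) monoid_scheme \<Rightarrow> 'a set \<Rightarrow> ('a list \<Rightarrow> 'g) \<Rightarrow> 'a list set \<Rightarrow> (real \<Rightarrow> real) \<Rightarrow> bool" where
  "departure_function G A \<pi> L D \<longleftrightarrow>
     (\<forall>r\<ge>0. D r \<ge> 0)
     \<and> (\<forall>w\<in>L. \<forall>r\<ge>0. \<forall>s t :: nat. real t \<ge> D r \<and> s + t \<le> length w \<longrightarrow>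
          real (alphabet_dist G A \<pi> (\<pi> (take s w)) (\<pi> (take (s + t) w))) > r)"

definition fellow_travel ::
    "('g, 'm) monoid_scheme \<Rightarrow> 'a set \<Rightarrow> ('a list \<Rightarrow> 'g) \<Rightarrow> real \<Rightarrow> 'a list \<Rightarrow> 'a list \<Rightarrow> bool" where
  "fellow_travel G A \<pi> p u v \<longleftrightarrow>
     (\<forall>n. real (alphabet_dist G A \<pi> (\<pi> (take n u)) (\<pi> (take n v))) \<le> p)"

definition MFT ::
    "('g, 'm) monoid_scheme \<Rightarrow> 'a set \<Rightarrow> ('a list \<Rightarrow> 'g) \<Rightarrow> real \<Rightarrow> 'a list \<Rightarrow> 'a list \<Rightarrow> bool" where
  "MFT G A \<pi> p u v \<longleftrightarrow> fellow_travel G A \<pi> p u v \<and> \<pi> u = \<pi> v"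

definition FT_BRP ::
    "('g, 'm) monoid_scheme \<Rightarrow> 'a set \<Rightarrow> ('a list \<Rightarrow> 'g) \<Rightarrow> 'b set \<Rightarrow> ('b list \<Rightarrow> 'g)
       \<Rightarrow> ('g \<Rightarrow> 'g) \<Rightarrow> 'a list set \<Rightarrow> 'b list set \<Rightarrow> bool" where
  "FT_BRP G A \<pi>\<^sub>1 B \<pi>\<^sub>2 \<phi> L\<^sub>1 L\<^sub>2 \<longleftrightarrow>
     (\<forall>p\<ge>0. \<exists>q\<ge>0. \<forall>u\<^sub>1\<in>L\<^sub>1. \<forall>u\<^sub>2\<in>L\<^sub>1. \<forall>u\<^sub>3\<in>L\<^sub>1. \<forall>u\<^sub>1'\<in>L\<^sub>2. \<forall>u\<^sub>2'\<in>L\<^sub>2. \<forall>u\<^sub>3'\<in>L\<^sub>2.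
        \<pi>\<^sub>2 u\<^sub>1' = \<phi> (\<pi>\<^sub>1 u\<^sub>1) \<and> \<pi>\<^sub>2 u\<^sub>2' = \<phi> (\<pi>\<^sub>1 u\<^sub>2) \<and> \<pi>\<^sub>2 u\<^sub>3' = \<phi> (\<pi>\<^sub>1 u\<^sub>3)
        \<and> MFT G A \<pi>\<^sub>1 p (u\<^sub>1 @ u\<^sub>2) u\<^sub>3
        \<longrightarrow> MFT G B \<pi>\<^sub>2 q (u\<^sub>1' @ u\<^sub>2') u\<^sub>3')"

definition path_image ::
    "('g, 'm) monoid_scheme \<Rightarrow> ('a list \<Rightarrow> 'g) \<Rightarrow> 'g \<Rightarrow> 'a list \<Rightarrow> 'g set" where
  "path_image G \<pi> x u = (\<lambda>n. x \<otimes>\<^bsub>G\<^esub> \<pi> (take n u)) ` {0..length u}"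

definition hausdorff_dist :: "('g \<Rightarrow> 'g \<Rightarrow> nat) \<Rightarrow> 'g set \<Rightarrow> 'g set \<Rightarrow> ereal" where
  "hausdorff_dist d X Y =
     max (SUP x\<in>X. INF y\<in>Y. ereal (real (d x y))) (SUP y\<in>Y. INF x\<in>X. ereal (real (d x y)))"

text \<open>\<open>S\<close> is the finite generating set whose word metric measures the Hausdorff distance.\<close>

definition BRP ::
    "('g, 'm) monoid_scheme \<Rightarrow> 'g set \<Rightarrow> ('a list \<Rightarrow> 'g) \<Rightarrow> ('b list \<Rightarrow> 'g)
       \<Rightarrow> ('g \<Rightarrow> 'g) \<Rightarrow> 'a list set \<Rightarrow> 'b list set \<Rightarrow> bool" where
  "BRP G S \<pi>\<^sub>1 \<pi>\<^sub>2 \<phi> L\<^sub>1 L\<^sub>2 \<longleftrightarrow>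
     (\<exists>N>0. \<forall>x\<in>carrier G. \<forall>\<alpha>\<in>L\<^sub>1. \<forall>\<beta>\<in>L\<^sub>2. \<pi>\<^sub>2 \<beta> = \<phi> (\<pi>\<^sub>1 \<alpha>) \<longrightarrow>
        hausdorff_dist (word_dist G S) (\<phi> ` path_image G \<pi>\<^sub>1 x \<alpha>) (path_image G \<pi>\<^sub>2 (\<phi> x) \<beta>)
          \<le> ereal N)"

end

theory Submission
  imports Defs
begin

text \<open>
  Since \<open>\<pi>\<^sub>2 (u\<^sub>1' @ u\<^sub>2')\<close> and \<open>\<pi>\<^sub>2 u\<^sub>3'\<close> agree because \<open>\<phi>\<close> is a homomorphism, the point is
  that the two paths travel together at equal speed.

  Let \<open>k = length u\<^sub>1\<close>. The words \<open>u\<^sub>1 @ u\<^sub>2\<close> and \<open>u\<^sub>3\<close> being fellow travellers, \<open>\<pi>\<^sub>1 u\<^sub>1\<close> is close to the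
  vertex of the path \<open>u\<^sub>3\<close> at time \<open>k\<close>. As \<open>\<phi>\<close> is Lipschitz for word metrics
  (\<open>word_dist_hom_lipschitz\<close>) and the BRP puts the image of that vertex close to the path \<open>u\<^sub>3'\<close>
  (\<open>BRP_path_near\<close>), the vertex \<open>\<pi>\<^sub>2 u\<^sub>1'\<close> is close to \<open>\<pi>\<^sub>2 (take m u\<^sub>3')\<close> for some \<open>m\<close>. From here on
  only the language \<open>L\<^sub>2\<close> matters (\<open>concatenation_fellow_travels\<close>). Cut \<open>u\<^sub>3' = a @ b\<close> at time \<open>m\<close>.

  Prefixes and suffixes of words of \<open>L\<^sub>2\<close> are within bounded length of words of \<open>L\<^sub>2\<close>, because in a
  finite automaton an accepting run can be completed by a bounded detour. So \<open>a @ z \<in> L\<^sub>2\<close> and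
  \<open>y @ b \<in> L\<^sub>2\<close> with \<open>z\<close> and \<open>y\<close> short. The words \<open>u\<^sub>1'\<close> and \<open>a @ z\<close> start together and end close to
  each other, hence fellow travel (\<open>right_fellow_travel\<close>); \<open>u\<^sub>2'\<close> and \<open>y @ b\<close>, read from the starting
  points that make them end together, start close to each other, hence fellow travel by
  biautomaticity (\<open>left_fellow_travel\<close>).

  This controls the two halves separately, but the second halves begin at times \<open>length u\<^sub>1'\<close> and
  \<open>m\<close>, and these must not drift apart. The departure function ensures this: of two fellow
  travelling words of \<open>L\<^sub>2\<close> with close endpoints, the longer one cannot linger near its endpoint
  after the shorter one has stopped (\<open>length_diff_bounded\<close>).
\<close>

section \<open>Bounded completion in rational languages\<close>

lemma fsa_path_append:
  "fsa_path T p (u @ v) q \<longleftrightarrow> (\<exists>r. fsa_path T p u r \<and> fsa_path T r v q)"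
  by (induction u arbitrary: p) auto

lemma fsa_path_states:
  assumes "trans M \<subseteq> states M \<times> X \<times> states M" "fsa_path (trans M) p w q" "p \<in> states M"
  shows "q \<in> states M"
  using assms(2,3)
proof (induction w arbitrary: p)
  case (Cons x w)
  then show ?case using assms(1) by fastforce
qed simp

lemma finite_uniform_bound:
  fixes P :: "'x \<Rightarrow> nat \<Rightarrow> bool"
  assumes "finite F" "\<And>x. x \<in> F \<Longrightarrow> \<exists>c. P x c"
    and mono: "\<And>x c c'. P x c \<Longrightarrow> c \<le> c' \<Longrightarrow> P x c'"
  shows "\<exists>c. \<forall>x\<in>F. P x c"
  using assms(1,2)
proof (induction F rule: finite_induct)
  case (insert x F)
  then obtain c c' where "\<forall>y\<in>F. P y c" "P x c'" by blast
  then have "\<forall>y\<in>insert x F. P y (max c c')"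
    using mono by (metis insert_iff max.cobounded1 max.cobounded2)
  then show ?case ..
qed simp

text \<open>A completion of \<open>w\<close> depends only on the state reached after \<open>w\<close>, and there are finitely many
  states, so one completion per state gives the bound.\<close>

lemma fsa_bounded_completion:
  assumes "fsa_recognized X K"
  shows "\<exists>c. \<forall>w w'. w @ w' \<in> K \<longrightarrow> (\<exists>z. length z \<le> c \<and> w @ z \<in> K)"
proof -
  obtain M :: "(nat, _) fsa" where M: "fsa_over X M" "fsa_language M = K"
    using assms unfolding fsa_recognized_def by auto
  define accepts where "accepts s z \<longleftrightarrow> (\<exists>q\<in>finals M. fsa_path (trans M) s z q)" for s z
  have "\<exists>c. \<forall>s\<in>states M. (\<exists>z. accepts s z) \<longrightarrow> (\<exists>z. length z \<le> c \<and> accepts s z)"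
  proof (rule finite_uniform_bound)
    show "finite (states M)" using M(1) by (simp add: fsa_over_def)
  qed (blast, meson le_trans)
  then obtain c where c:
    "\<And>s z. s \<in> states M \<Longrightarrow> accepts s z \<Longrightarrow> \<exists>z. length z \<le> c \<and> accepts s z" by blast
  have "\<exists>z. length z \<le> c \<and> w @ z \<in> K" if ww: "w @ w' \<in> K" for w w'
  proof -
    obtain p s where p: "p \<in> initials M" "fsa_path (trans M) p w s" "accepts s w'"
      using ww unfolding M(2)[symmetric] fsa_language_def accepts_def
      by (auto simp: fsa_path_append)
    then have "s \<in> states M"
      using M(1) fsa_path_states[of M X p w s] unfolding fsa_over_def by auto
    with c p(3) obtain z where "length z \<le> c" "accepts s z" by blast
    with p show ?thesis unfolding M(2)[symmetric] fsa_language_def accepts_def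
      by (auto simp: fsa_path_append)
  qed
  then show ?thesis by blast
qed

text \<open>The mirror image: a word leading from an initial state to the given state replaces the
  deleted prefix.\<close>

lemma fsa_bounded_cocompletion:
  assumes "fsa_recognized X K"
  shows "\<exists>c. \<forall>w w'. w' @ w \<in> K \<longrightarrow> (\<exists>z. length z \<le> c \<and> z @ w \<in> K)"
proof -
  obtain M :: "(nat, _) fsa" where M: "fsa_over X M" "fsa_language M = K"
    using assms unfolding fsa_recognized_def by auto
  define reaches where "reaches s z \<longleftrightarrow> (\<exists>p\<in>initials M. fsa_path (trans M) p z s)" for s z
  have "\<exists>c. \<forall>s\<in>states M. (\<exists>z. reaches s z) \<longrightarrow> (\<exists>z. length z \<le> c \<and> reaches s z)"
  proof (rule finite_uniform_bound)
    show "finite (states M)" using M(1) by (simp add: fsa_over_def)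
  qed (blast, meson le_trans)
  then obtain c where c:
    "\<And>s z. s \<in> states M \<Longrightarrow> reaches s z \<Longrightarrow> \<exists>z. length z \<le> c \<and> reaches s z" by blast
  have "\<exists>z. length z \<le> c \<and> z @ w \<in> K" if ww: "w' @ w \<in> K" for w w'
  proof -
    obtain q s where q: "q \<in> finals M" "fsa_path (trans M) s w q" "reaches s w'"
      using ww unfolding M(2)[symmetric] fsa_language_def reaches_def
      by (auto simp: fsa_path_append)
    then have "s \<in> states M"
      using M(1) fsa_path_states[of M X _ w' s] unfolding fsa_over_def reaches_def by blast
    with c q(3) obtain z where "length z \<le> c" "reaches s z" by blast
    with q show ?thesis unfolding M(2)[symmetric] fsa_language_def reaches_def
      by (auto simp: fsa_path_append)
  qed
  then show ?thesis by blast
qed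

text \<open>Dropping the padding symbols recovers the two words from \<open>u \<diamondop> v\<close>, and this commutes with
  cutting at any position, including positions inside the padding. Thus bounded completion of
  padded words descends to bounded completion of the pairs of words that they encode.\<close>

lemma unpad_take_diamond:
  "List.map_filter fst (take n (u \<diamondop> v)) = take n u \<and>
   List.map_filter snd (take n (u \<diamondop> v)) = take n v"
proof (induction u v arbitrary: n rule: diamond.induct)
  case (2 a u)
  then show ?case by (cases n) (auto simp: List.map_filter_def)
next
  case (3 b v)
  then show ?case by (cases n) (auto simp: List.map_filter_def)
next
  case (4 a u b v)
  then show ?case by (cases n) (auto simp: List.map_filter_def)
qed (simp add: List.map_filter_def)

lemma unpad_drop_diamond:
  "List.map_filter fst (drop n (u \<diamondop> v)) = drop n u \<and>
   List.map_filter snd (drop n (u \<diamondop> v)) = drop n v"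
proof (induction u v arbitrary: n rule: diamond.induct)
  case (2 a u)
  from 2[of 0] 2[of "n - 1"] show ?case by (cases n) (auto simp: List.map_filter_def)
next
  case (3 b v)
  from 3[of 0] 3[of "n - 1"] show ?case by (cases n) (auto simp: List.map_filter_def)
next
  case (4 a u b v)
  from 4[of 0] 4[of "n - 1"] show ?case by (cases n) (auto simp: List.map_filter_def)
qed (simp add: List.map_filter_def)

lemma unpad_diamond:
  "List.map_filter fst (u \<diamondop> v) = u" "List.map_filter snd (u \<diamondop> v) = v"
  using unpad_drop_diamond[of 0 u v] by simp_all

lemma map_filter_append:
  "List.map_filter f (xs @ ys) = List.map_filter f xs @ List.map_filter f ys"
  by (simp add: List.map_filter_def)

lemma length_map_filter_le: "length (List.map_filter f xs) \<le> length xs"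
  by (simp add: List.map_filter_def)

lemma diamond_bounded_completion:
  assumes "fsa_recognized X {u \<diamondop> v | u v. R u v}"
  shows "\<exists>c. \<forall>u v n. R u v \<longrightarrow>
    (\<exists>z z'. length z \<le> c \<and> length z' \<le> c \<and> R (take n u @ z) (take n v @ z'))"
proof -
  let ?K = "{u \<diamondop> v | u v. R u v}"
  obtain c where c: "\<And>w w'. w @ w' \<in> ?K \<Longrightarrow> \<exists>z. length z \<le> c \<and> w @ z \<in> ?K"
    using fsa_bounded_completion[OF assms] by blast
  have "\<exists>z z'. length z \<le> c \<and> length z' \<le> c \<and> R (take n u @ z) (take n v @ z')"
    if "R u v" for u v n
  proof -
    have "take n (u \<diamondop> v) @ drop n (u \<diamondop> v) \<in> ?K" using that by auto
    from c[OF this] obtain z u' v' where z: "length z \<le> c"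
      and eq: "take n (u \<diamondop> v) @ z = u' \<diamondop> v'" and R: "R u' v'" by auto
    have "u' = take n u @ List.map_filter fst z" "v' = take n v @ List.map_filter snd z"
      using arg_cong[OF eq, of "List.map_filter fst"] arg_cong[OF eq, of "List.map_filter snd"]
      by (simp_all add: map_filter_append unpad_take_diamond unpad_diamond)
    with R z show ?thesis by (metis le_trans length_map_filter_le)
  qed
  then show ?thesis by blast
qed

lemma diamond_bounded_cocompletion:
  assumes "fsa_recognized X {u \<diamondop> v | u v. R u v}"
  shows "\<exists>c. \<forall>u v n. R u v \<longrightarrow>
    (\<exists>z z'. length z \<le> c \<and> length z' \<le> c \<and> R (z @ drop n u) (z' @ drop n v))"
proof -
  let ?K = "{u \<diamondop> v | u v. R u v}"
  obtain c where c: "\<And>w w'. w' @ w \<in> ?K \<Longrightarrow> \<exists>z. length z \<le> c \<and> z @ w \<in> ?K"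
    using fsa_bounded_cocompletion[OF assms] by blast
  have "\<exists>z z'. length z \<le> c \<and> length z' \<le> c \<and> R (z @ drop n u) (z' @ drop n v)"
    if "R u v" for u v n
  proof -
    have "take n (u \<diamondop> v) @ drop n (u \<diamondop> v) \<in> ?K" using that by auto
    from c[OF this] obtain z u' v' where z: "length z \<le> c"
      and eq: "z @ drop n (u \<diamondop> v) = u' \<diamondop> v'" and R: "R u' v'" by auto
    have "u' = List.map_filter fst z @ drop n u" "v' = List.map_filter snd z @ drop n v"
      using arg_cong[OF eq, of "List.map_filter fst"] arg_cong[OF eq, of "List.map_filter snd"]
      by (simp_all add: map_filter_append unpad_drop_diamond unpad_diamond)
    with R z show ?thesis by (metis le_trans length_map_filter_le)
  qed
  then show ?thesis by blast
qed

section \<open>Word metrics\<close>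

locale generated_group = group G for G :: "('g, 'm) monoid_scheme" (structure) +
  fixes S :: "'g set"
  assumes gens_closed: "S \<subseteq> carrier G" and gens_generate: "generate G S = carrier G"
begin

abbreviation "d \<equiv> word_dist G S"

lemma adj_carrier: "(g, h) \<in> cayley_adj G S \<Longrightarrow> g \<in> carrier G \<and> h \<in> carrier G"
  by (simp add: cayley_adj_def)

lemma adj_sym: "(g, h) \<in> cayley_adj G S \<Longrightarrow> (h, g) \<in> cayley_adj G S"
  by (auto simp: cayley_adj_def)

lemma adj_generator: "g \<in> carrier G \<Longrightarrow> s \<in> S \<Longrightarrow> (g, g \<otimes> s) \<in> cayley_adj G S"
  using gens_closed by (auto simp: cayley_adj_def)

lemma adj_translate:
  "x \<in> carrier G \<Longrightarrow> (g, h) \<in> cayley_adj G S \<Longrightarrow> (x \<otimes> g, x \<otimes> h) \<in> cayley_adj G S"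
  using gens_closed by (fastforce simp: cayley_adj_def m_assoc[symmetric])

lemma adj_relpow_sym: "(g, h) \<in> cayley_adj G S ^^ n \<Longrightarrow> (h, g) \<in> cayley_adj G S ^^ n"
proof (induction n arbitrary: h)
  case (Suc n)
  then show ?case by (blast intro: relpow_Suc_I2 adj_sym elim: relpow_Suc_E)
qed simp

lemma adj_relpow_translate:
  "x \<in> carrier G \<Longrightarrow> (g, h) \<in> cayley_adj G S ^^ n \<Longrightarrow>
    (x \<otimes> g, x \<otimes> h) \<in> cayley_adj G S ^^ n"
proof (induction n arbitrary: h)
  case (Suc n)
  then show ?case by (auto intro: adj_translate)
qed simp

lemma adj_connected:
  assumes "g \<in> carrier G" "h \<in> carrier G"
  shows "(g, h) \<in> (cayley_adj G S)\<^sup>*"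
proof -
  have "(g, g \<otimes> x) \<in> (cayley_adj G S)\<^sup>*" if "x \<in> generate G S" "g \<in> carrier G" for g x
    using that
  proof (induction arbitrary: g rule: generate.induct)
    case (incl s)
    then show ?case by (simp add: adj_generator r_into_rtrancl)
  next
    case (inv s)
    then have s: "s \<in> carrier G" using gens_closed by auto
    then have "(g \<otimes> inv s, g) \<in> cayley_adj G S"
      using adj_generator[of "g \<otimes> inv s" s] inv by (simp add: m_assoc)
    then show ?case by (blast intro: adj_sym)
  next
    case (eng x y)
    then have "x \<in> carrier G" "y \<in> carrier G" using gens_generate by auto
    with eng.IH(1)[of g] eng.IH(2)[of "g \<otimes> x"] eng.prems show ?case
      by (simp add: m_assoc)
  qed simp
  from this[of "inv g \<otimes> h" g] show ?thesis
    using assms gens_generate by (simp add: inv_solve_left m_assoc[symmetric])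
qed

lemma dist_le_relpow: "(g, h) \<in> cayley_adj G S ^^ n \<Longrightarrow> d g h \<le> n"
  unfolding word_dist_def by (rule Least_le)

lemma relpow_dist:
  assumes "g \<in> carrier G" "h \<in> carrier G"
  shows "(g, h) \<in> cayley_adj G S ^^ d g h"
  using adj_connected[OF assms] unfolding word_dist_def
  by (metis (mono_tags, lifting) LeastI rtrancl_imp_relpow)

lemma dist_self [simp]: "d g g = 0"
  using dist_le_relpow[of g g 0] by simp

lemma dist_commute: "g \<in> carrier G \<Longrightarrow> h \<in> carrier G \<Longrightarrow> d g h = d h g"
  by (meson adj_relpow_sym dist_le_relpow le_antisym relpow_dist)

lemma dist_triangle:
  assumes "g \<in> carrier G" "h \<in> carrier G" "k \<in> carrier G"
  shows "d g k \<le> d g h + d h k"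
proof (rule dist_le_relpow)
  show "(g, k) \<in> cayley_adj G S ^^ (d g h + d h k)"
    unfolding relpow_add using relpow_dist assms by blast
qed

lemma dist_translate_le:
  "x \<in> carrier G \<Longrightarrow> g \<in> carrier G \<Longrightarrow> h \<in> carrier G \<Longrightarrow> d (x \<otimes> g) (x \<otimes> h) \<le> d g h"
  by (simp add: adj_relpow_translate dist_le_relpow relpow_dist)

lemma dist_adj_le: "(g, h) \<in> cayley_adj G S \<Longrightarrow> d g h \<le> 1"
  using dist_le_relpow[of g h 1] by simp

text \<open>The induction step along a geodesic. The case \<open>k = h\<close> covers \<open>g = h\<close>, where there is no
  preceding vertex, so that the step applies to any bound on the distance.\<close>

lemma dist_SucE:
  assumes "g \<in> carrier G" "h \<in> carrier G" "d g h \<le> Suc n"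
  obtains k where "k \<in> carrier G" "d g k \<le> n" "k = h \<or> (k, h) \<in> cayley_adj G S"
proof (cases "d g h")
  case 0
  then show ?thesis using that[of h] assms by simp
next
  case (Suc m)
  then obtain k where "(g, k) \<in> cayley_adj G S ^^ m" "(k, h) \<in> cayley_adj G S"
    using relpow_dist[OF assms(1,2)] by auto
  moreover have "m \<le> n" using Suc assms(3) by simp
  ultimately show ?thesis
    using that[of k] dist_le_relpow[of g k m] adj_carrier by auto
qed

end

text \<open>The images of the finitely many generators have bounded length, and every step of a geodesic
  multiplies by one generator or its inverse. With the identity for \<open>\<psi>\<close> this compares the word
  metrics of two finite generating sets.\<close>

lemma word_dist_hom_lipschitz:
  assumes "generated_group G S" "finite S" "generated_group G T" "\<psi> \<in> hom G G"
  shows "\<exists>C. \<forall>g\<in>carrier G. \<forall>h\<in>carrier G.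
    word_dist G T (\<psi> g) (\<psi> h) \<le> C * word_dist G S g h"
proof -
  interpret S: generated_group G S by fact
  interpret T: generated_group G T by fact
  have \<psi>: "\<And>g. g \<in> carrier G \<Longrightarrow> \<psi> g \<in> carrier G"
    "\<And>g h. g \<in> carrier G \<Longrightarrow> h \<in> carrier G \<Longrightarrow> \<psi> (g \<otimes>\<^bsub>G\<^esub> h) = \<psi> g \<otimes>\<^bsub>G\<^esub> \<psi> h"
    using assms(4) by (auto simp: hom_def)
  have "\<exists>C. \<forall>s\<in>S. T.d \<one>\<^bsub>G\<^esub> (\<psi> s) \<le> C"
    by (rule finite_uniform_bound) (use assms(2) in auto)
  then obtain C where C: "\<And>s. s \<in> S \<Longrightarrow> T.d \<one>\<^bsub>G\<^esub> (\<psi> s) \<le> C" by blast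
  have gen: "T.d (\<psi> g) (\<psi> (g \<otimes>\<^bsub>G\<^esub> s)) \<le> C" if "g \<in> carrier G" "s \<in> S" for g s
    using T.dist_translate_le[of "\<psi> g" "\<one>\<^bsub>G\<^esub>" "\<psi> s"] C[of s] that \<psi> S.gens_closed by fastforce
  have adj: "T.d (\<psi> g) (\<psi> h) \<le> C" if "(g, h) \<in> cayley_adj G S" for g h
    using that gen T.dist_commute \<psi>(1) unfolding cayley_adj_def by fastforce
  have "T.d (\<psi> g) (\<psi> h) \<le> C * n"
    if "g \<in> carrier G" "h \<in> carrier G" "(g, h) \<in> cayley_adj G S ^^ n" for g h n
    using that(2,3)
  proof (induction n arbitrary: h)
    case (Suc n)
    then obtain k where k: "(g, k) \<in> cayley_adj G S ^^ n" "(k, h) \<in> cayley_adj G S" by auto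
    then have "k \<in> carrier G" using S.adj_carrier by blast
    then show ?case
      using T.dist_triangle[of "\<psi> g" "\<psi> k" "\<psi> h"] Suc.IH[of k] adj[OF k(2)] k \<psi>(1) that(1) Suc.prems(1)
      by fastforce
  qed simp
  then show ?thesis using S.relpow_dist by blast
qed

section \<open>Words over a generating alphabet\<close>

locale alphabet_group = group G for G :: "('g, 'm) monoid_scheme" (structure) +
  fixes A :: "'a set" and \<pi> :: "'a list \<Rightarrow> 'g"
  assumes finite_alphabet: "finite A" and surj: "surj_monoid_hom A \<pi> G"
begin

abbreviation "letters \<equiv> (\<lambda>a. \<pi> [a]) ` A"

lemma eval_image: "\<pi> ` lists A = carrier G"
  using surj by (simp add: surj_monoid_hom_def)

lemma eval_carrier [simp]: "u \<in> lists A \<Longrightarrow> \<pi> u \<in> carrier G"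
  using imageI[of u "lists A" \<pi>] by (simp only: eval_image)

lemma eval_Nil [simp]: "\<pi> [] = \<one>"
  using surj by (simp add: surj_monoid_hom_def)

lemma eval_append [simp]: "u \<in> lists A \<Longrightarrow> v \<in> lists A \<Longrightarrow> \<pi> (u @ v) = \<pi> u \<otimes> \<pi> v"
  using surj unfolding surj_monoid_hom_def by metis

lemma take_in_lists: "u \<in> lists A \<Longrightarrow> take n u \<in> lists A"
  by (auto dest: in_set_takeD)

lemma drop_in_lists: "u \<in> lists A \<Longrightarrow> drop n u \<in> lists A"
  by (auto dest: in_set_dropD)

lemma eval_take_carrier [simp]: "u \<in> lists A \<Longrightarrow> \<pi> (take n u) \<in> carrier G"
  by (simp add: take_in_lists)

lemma eval_generated: "u \<in> lists A \<Longrightarrow> \<pi> u \<in> generate G letters"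
proof (induction u)
  case (Cons a u)
  then have "\<pi> (a # u) = \<pi> [a] \<otimes> \<pi> u" using eval_append[of "[a]" u] by simp
  moreover have "\<pi> [a] \<in> generate G letters" "\<pi> u \<in> generate G letters"
    using Cons by (auto intro: generate.incl)
  ultimately show ?case by (simp add: generate.eng)
qed (simp add: generate.one)

sublocale generated_group G letters
proof
  show closed: "letters \<subseteq> carrier G" by auto
  show "generate G letters = carrier G"
  proof
    show "generate G letters \<subseteq> carrier G"
      using generate_in_carrier[OF closed] by blast
    show "carrier G \<subseteq> generate G letters"
      unfolding eval_image[symmetric] using eval_generated by blast
  qed
qed

lemma dist_eval_le:
  assumes "g \<in> carrier G" "u \<in> lists A"
  shows "d g (g \<otimes> \<pi> u) \<le> length u"
  using assms
proof (induction u arbitrary: g)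
  case Nil
  then show ?case by simp
next
  case (Cons a u)
  then have a: "a \<in> A" "\<pi> [a] \<in> carrier G" and u: "u \<in> lists A" "\<pi> u \<in> carrier G" by auto
  have "\<pi> (a # u) = \<pi> [a] \<otimes> \<pi> u" using eval_append[of "[a]" u] a(1) u(1) by simp
  then have eq: "g \<otimes> \<pi> (a # u) = g \<otimes> \<pi> [a] \<otimes> \<pi> u"
    using m_assoc[OF Cons.prems(1) a(2) u(2)] by (simp only:)
  have ga: "g \<otimes> \<pi> [a] \<in> carrier G" using Cons.prems(1) a(2) by (rule m_closed)
  have "d g (g \<otimes> \<pi> [a]) \<le> 1"
    by (rule dist_adj_le, rule adj_generator) (use Cons.prems(1) a(1) in auto)
  moreover have "d (g \<otimes> \<pi> [a]) (g \<otimes> \<pi> [a] \<otimes> \<pi> u) \<le> length u"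
    by (rule Cons.IH[OF ga u(1)])
  moreover have "d g (g \<otimes> \<pi> (a # u))
      \<le> d g (g \<otimes> \<pi> [a]) + d (g \<otimes> \<pi> [a]) (g \<otimes> \<pi> [a] \<otimes> \<pi> u)"
    unfolding eq by (rule dist_triangle[OF Cons.prems(1) ga m_closed[OF ga u(2)]])
  ultimately show ?case by simp
qed

lemma dist_take_take_le:
  assumes "w \<in> lists A"
  shows "d (\<pi> (take i w)) (\<pi> (take j w)) \<le> (i - j) + (j - i)"
proof -
  have *: "d (\<pi> (take i w)) (\<pi> (take j w)) \<le> j - i" if "i \<le> j" for i j
  proof -
    define v where "v = take (j - i) (drop i w)"
    have v: "v \<in> lists A" "length v \<le> j - i"
      unfolding v_def using assms by (simp_all add: take_in_lists drop_in_lists)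
    have "take j w = take i w @ v"
      unfolding v_def using that take_add[of i "j - i" w] by simp
    then have "\<pi> (take j w) = \<pi> (take i w) \<otimes> \<pi> v"
      using take_in_lists[OF assms] v(1) by simp
    then show ?thesis
      using dist_eval_le[OF eval_take_carrier[OF assms] v(1), of i] v(2) by simp
  qed
  show ?thesis
    using *[of i j] *[of j i] assms
      dist_commute[OF eval_take_carrier[OF assms] eval_take_carrier[OF assms], of i j]
    by (cases "i \<le> j") simp_all
qed

lemma dist_le_common_end:
  assumes "g \<in> carrier G" "h \<in> carrier G" "z \<in> lists A" "z' \<in> lists A"
    and "g \<otimes> \<pi> z = h \<otimes> \<pi> z'"
  shows "d g h \<le> length z + length z'"
proof -
  have "d g h \<le> d g (g \<otimes> \<pi> z) + d (h \<otimes> \<pi> z') h"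
    using dist_triangle[of g "g \<otimes> \<pi> z" h] assms by simp
  then show ?thesis
    using dist_eval_le[of g z] dist_eval_le[of h z'] dist_commute[of h "h \<otimes> \<pi> z'"] assms
    by simp
qed

end

section \<open>Fellow travelling\<close>

locale automatic_group_structure = alphabet_group G A \<pi>
  for G :: "('g, 'm) monoid_scheme" (structure) and A :: "'a set" and \<pi> +
  fixes L :: "'a list set"
  assumes automatic: "automatic_structure G A \<pi> L"
begin

lemma lang_words: "u \<in> L \<Longrightarrow> u \<in> lists A"
  using automatic unfolding automatic_structure_def by blast

lemma lang_surj: "g \<in> carrier G \<Longrightarrow> \<exists>u\<in>L. \<pi> u = g"
proof -
  assume "g \<in> carrier G"
  then have "g \<in> \<pi> ` L" using automatic by (simp add: automatic_structure_def)
  then show ?thesis by blast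
qed

lemma finite_labels: "finite (insert [] {[a] | a. a \<in> A})"
  using finite_alphabet by simp

lemma diagonal_recognized:
  "fsa_recognized (padded_alphabet A) {u \<diamondop> v | u v. u \<in> L \<and> v \<in> L \<and> \<pi> v = \<pi> u}"
  using automatic unfolding automatic_structure_def by force

text \<open>The recognized language of pairs with equal value contains every \<open>u \<diamondop> u\<close>, so completing its
  words completes the words of \<open>L\<close> itself.\<close>

lemma prefix_completion:
  "\<exists>c. \<forall>u\<in>L. \<forall>n. \<exists>z\<in>lists A. length z \<le> c \<and> take n u @ z \<in> L"
proof -
  obtain c where c: "\<And>u v n. u \<in> L \<and> v \<in> L \<and> \<pi> v = \<pi> u \<Longrightarrow>
    \<exists>z z'. length z \<le> c \<and> length z' \<le> c \<and> (take n u @ z \<in> L \<and> take n v @ z' \<in> L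
      \<and> \<pi> (take n v @ z') = \<pi> (take n u @ z))"
    using diamond_bounded_completion[OF diagonal_recognized] by blast
  have "\<exists>z\<in>lists A. length z \<le> c \<and> take n u @ z \<in> L" if u: "u \<in> L" for u n
  proof -
    obtain z where z: "length z \<le> c" "take n u @ z \<in> L" using c[of u u n] u by blast
    then have "z \<in> lists A" using lang_words[OF z(2)] by simp
    with z show ?thesis by blast
  qed
  then show ?thesis by blast
qed

lemma suffix_completion:
  "\<exists>c. \<forall>u\<in>L. \<forall>n. \<exists>z\<in>lists A. length z \<le> c \<and> z @ drop n u \<in> L"
proof -
  obtain c where c: "\<And>u v n. u \<in> L \<and> v \<in> L \<and> \<pi> v = \<pi> u \<Longrightarrow>
    \<exists>z z'. length z \<le> c \<and> length z' \<le> c \<and> (z @ drop n u \<in> L \<and> z' @ drop n v \<in> L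
      \<and> \<pi> (z' @ drop n v) = \<pi> (z @ drop n u))"
    using diamond_bounded_cocompletion[OF diagonal_recognized] by blast
  have "\<exists>z\<in>lists A. length z \<le> c \<and> z @ drop n u \<in> L" if u: "u \<in> L" for u n
  proof -
    obtain z where z: "length z \<le> c" "z @ drop n u \<in> L" using c[of u u n] u by blast
    then have "z \<in> lists A" using lang_words[OF z(2)] by simp
    with z show ?thesis by blast
  qed
  then show ?thesis by blast
qed

text \<open>Stop both words at time \<open>n\<close>. Short completions \<open>z\<close>, \<open>z'\<close> again yield a pair that differs by
  \<open>x\<close> on the right, so \<open>z @ x\<close> and \<open>z'\<close> join the two vertices at time \<open>n\<close> by a short path.\<close>

lemma right_fellow_travel_step:
  "\<exists>c. \<forall>x\<in>insert [] {[a] | a. a \<in> A}. \<forall>u\<in>L. \<forall>v\<in>L. \<pi> v = \<pi> (u @ x) \<longrightarrow>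
    (\<forall>n. d (\<pi> (take n u)) (\<pi> (take n v)) \<le> c)"
proof (rule finite_uniform_bound[OF finite_labels])
  fix x assume x: "x \<in> insert [] {[a] | a. a \<in> A}"
  then have xA: "x \<in> lists A" by auto
  have "fsa_recognized (padded_alphabet A) {u \<diamondop> v | u v. u \<in> L \<and> v \<in> L \<and> \<pi> v = \<pi> (u @ x)}"
    using automatic x unfolding automatic_structure_def by blast
  from diamond_bounded_completion[OF this] obtain c where
    c: "\<And>u v n. u \<in> L \<and> v \<in> L \<and> \<pi> v = \<pi> (u @ x) \<Longrightarrow>
      \<exists>z z'. length z \<le> c \<and> length z' \<le> c \<and> (take n u @ z \<in> L \<and> take n v @ z' \<in> L
        \<and> \<pi> (take n v @ z') = \<pi> ((take n u @ z) @ x))"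
    by blast
  have "d (\<pi> (take n u)) (\<pi> (take n v)) \<le> c + length x + c"
    if uv: "u \<in> L" "v \<in> L" "\<pi> v = \<pi> (u @ x)" for u v n
  proof -
    obtain z z' where z: "length z \<le> c" "length z' \<le> c" "take n u @ z \<in> L" "take n v @ z' \<in> L"
      and eq: "\<pi> (take n v @ z') = \<pi> ((take n u @ z) @ x)"
      using c[of u v n] uv by blast
    have A: "take n u \<in> lists A" "z \<in> lists A" "take n v \<in> lists A" "z' \<in> lists A"
      using lang_words[OF z(3)] lang_words[OF z(4)] by simp_all
    have "\<pi> (take n u) \<otimes> \<pi> (z @ x) = \<pi> (take n v) \<otimes> \<pi> z'"
      using eq A xA by (simp add: m_assoc)
    with A xA have "d (\<pi> (take n u)) (\<pi> (take n v)) \<le> length (z @ x) + length z'"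
      by (intro dist_le_common_end) auto
    with z show ?thesis by simp
  qed
  then show "\<exists>c. \<forall>u\<in>L. \<forall>v\<in>L. \<pi> v = \<pi> (u @ x) \<longrightarrow>
    (\<forall>n. d (\<pi> (take n u)) (\<pi> (take n v)) \<le> c)" by blast
qed (meson le_trans)

text \<open>Every vertex on a geodesic between the two endpoints is the value of a word of \<open>L\<close>, and the
  words chosen for adjacent vertices fellow travel by the one-letter case.\<close>

lemma right_fellow_travel:
  "\<exists>c. \<forall>u\<in>L. \<forall>v\<in>L. d (\<pi> u) (\<pi> v) \<le> K \<longrightarrow> (\<forall>n. d (\<pi> (take n u)) (\<pi> (take n v)) \<le> c)"
proof (induction K)
  case 0
  obtain c where c: "\<And>u v n. u \<in> L \<Longrightarrow> v \<in> L \<Longrightarrow> \<pi> v = \<pi> (u @ []) \<Longrightarrow>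
      d (\<pi> (take n u)) (\<pi> (take n v)) \<le> c"
    using right_fellow_travel_step by blast
  have "\<pi> v = \<pi> u" if "u \<in> L" "v \<in> L" "d (\<pi> u) (\<pi> v) \<le> 0" for u v
    using relpow_dist[of "\<pi> u" "\<pi> v"] that lang_words eval_carrier by fastforce
  then show ?case using c by (metis append_Nil2)
next
  case (Suc K)
  then obtain c where c: "\<And>u v n. u \<in> L \<Longrightarrow> v \<in> L \<Longrightarrow> d (\<pi> u) (\<pi> v) \<le> K \<Longrightarrow>
      d (\<pi> (take n u)) (\<pi> (take n v)) \<le> c"
    by blast
  obtain c1 where c1: "\<And>x u v n. x \<in> insert [] {[a] | a. a \<in> A} \<Longrightarrow> u \<in> L \<Longrightarrow> v \<in> L \<Longrightarrow>
      \<pi> v = \<pi> (u @ x) \<Longrightarrow> d (\<pi> (take n u)) (\<pi> (take n v)) \<le> c1"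
    using right_fellow_travel_step by blast
  have "d (\<pi> (take n u)) (\<pi> (take n v)) \<le> c + c1"
    if uv: "u \<in> L" "v \<in> L" "d (\<pi> u) (\<pi> v) \<le> Suc K" for u v n
  proof -
    have A: "u \<in> lists A" "v \<in> lists A" using uv lang_words by auto
    obtain k where k: "k \<in> carrier G" "d (\<pi> u) k \<le> K" "k = \<pi> v \<or> (k, \<pi> v) \<in> cayley_adj G letters"
      using dist_SucE[OF _ _ uv(3)] A eval_carrier by blast
    obtain w where w: "w \<in> L" "\<pi> w = k" using lang_surj k(1) by blast
    have wA: "w \<in> lists A" using w lang_words by auto
    from k(3) consider "\<pi> v = \<pi> w" | a where "a \<in> A" "\<pi> v = \<pi> w \<otimes> \<pi> [a]"
      | a where "a \<in> A" "\<pi> w = \<pi> v \<otimes> \<pi> [a]"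
      unfolding cayley_adj_def w(2) by blast
    then have "d (\<pi> (take n w)) (\<pi> (take n v)) \<le> c1"
    proof cases
      case 1
      then show ?thesis using c1[of "[]" w v n] w uv by simp
    next
      case 2
      then show ?thesis using c1[of "[a]" w v n] w uv wA by simp
    next
      case 3
      then have "d (\<pi> (take n v)) (\<pi> (take n w)) \<le> c1"
        using c1[of "[a]" v w n] w uv A by simp
      then show ?thesis using dist_commute A wA by (metis eval_take_carrier)
    qed
    moreover have "d (\<pi> (take n u)) (\<pi> (take n w)) \<le> c" using c uv w k by blast
    ultimately show ?thesis
      using dist_triangle[of "\<pi> (take n u)" "\<pi> (take n w)" "\<pi> (take n v)"] A wA
      by simp
  qed
  then show ?case by blast
qed

end

locale biautomatic_group_structure = alphabet_group G A \<pi>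
  for G :: "('g, 'm) monoid_scheme" (structure) and A :: "'a set" and \<pi> +
  fixes L :: "'a list set"
  assumes biautomatic: "biautomatic_structure G A \<pi> L"
begin

sublocale automatic_group_structure G A \<pi> L
  using biautomatic by unfold_locales (simp add: biautomatic_structure_def)

text \<open>As in the case of right multiplication: short completions at time \<open>n\<close> yield a pair that again
  differs by \<open>x\<close> on the left, so they lead from the two vertices at time \<open>n\<close> to a common vertex.\<close>

lemma left_fellow_travel_step:
  "\<exists>c. \<forall>x\<in>insert [] {[a] | a. a \<in> A}. \<forall>u\<in>L. \<forall>v\<in>L. \<pi> v = \<pi> (x @ u) \<longrightarrow>
    (\<forall>n. d (\<pi> x \<otimes> \<pi> (take n u)) (\<pi> (take n v)) \<le> c)"
proof (rule finite_uniform_bound[OF finite_labels])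
  fix x assume x: "x \<in> insert [] {[a] | a. a \<in> A}"
  then have xA: "x \<in> lists A" by auto
  have "fsa_recognized (padded_alphabet A) {u \<diamondop> v | u v. u \<in> L \<and> v \<in> L \<and> \<pi> v = \<pi> (x @ u)}"
    using biautomatic x unfolding biautomatic_structure_def by blast
  from diamond_bounded_completion[OF this] obtain c where
    c: "\<And>u v n. u \<in> L \<and> v \<in> L \<and> \<pi> v = \<pi> (x @ u) \<Longrightarrow>
      \<exists>z z'. length z \<le> c \<and> length z' \<le> c \<and> (take n u @ z \<in> L \<and> take n v @ z' \<in> L
        \<and> \<pi> (take n v @ z') = \<pi> (x @ take n u @ z))"
    by blast
  have "d (\<pi> x \<otimes> \<pi> (take n u)) (\<pi> (take n v)) \<le> c + c"
    if uv: "u \<in> L" "v \<in> L" "\<pi> v = \<pi> (x @ u)" for u v n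
  proof -
    obtain z z' where z: "length z \<le> c" "length z' \<le> c" "take n u @ z \<in> L" "take n v @ z' \<in> L"
      and eq: "\<pi> (take n v @ z') = \<pi> (x @ take n u @ z)"
      using c[of u v n] uv by blast
    have A: "take n u \<in> lists A" "z \<in> lists A" "take n v \<in> lists A" "z' \<in> lists A"
      using lang_words[OF z(3)] lang_words[OF z(4)] by simp_all
    have "\<pi> x \<otimes> \<pi> (take n u) \<otimes> \<pi> z = \<pi> (take n v) \<otimes> \<pi> z'"
      using eq A xA by (simp add: m_assoc)
    with A xA have "d (\<pi> x \<otimes> \<pi> (take n u)) (\<pi> (take n v)) \<le> length z + length z'"
      by (intro dist_le_common_end) auto
    with z show ?thesis by simp
  qed
  then show "\<exists>c. \<forall>u\<in>L. \<forall>v\<in>L. \<pi> v = \<pi> (x @ u) \<longrightarrow>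
    (\<forall>n. d (\<pi> x \<otimes> \<pi> (take n u)) (\<pi> (take n v)) \<le> c)" by blast
qed (meson le_trans)

text \<open>The variant in which the paths end at the same vertex but start at nearby vertices \<open>g\<close>, \<open>h\<close>.
  Through each vertex \<open>k\<close> on a geodesic from \<open>g\<close> to \<open>h\<close> choose a word of \<open>L\<close> leading from \<open>k\<close> to the
  common end; words chosen for adjacent vertices differ by one letter on the left.\<close>

lemma left_fellow_travel:
  "\<exists>c. \<forall>g\<in>carrier G. \<forall>h\<in>carrier G. \<forall>u\<in>L. \<forall>v\<in>L. d g h \<le> K \<and> g \<otimes> \<pi> u = h \<otimes> \<pi> v \<longrightarrow>
    (\<forall>n. d (g \<otimes> \<pi> (take n u)) (h \<otimes> \<pi> (take n v)) \<le> c)"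
proof -
  obtain c1 where c1: "\<And>x u v n. x \<in> insert [] {[a] | a. a \<in> A} \<Longrightarrow> u \<in> L \<Longrightarrow> v \<in> L \<Longrightarrow>
      \<pi> v = \<pi> (x @ u) \<Longrightarrow> d (\<pi> x \<otimes> \<pi> (take n u)) (\<pi> (take n v)) \<le> c1"
    using left_fellow_travel_step by blast
  have step: "d (h \<otimes> \<pi> x \<otimes> \<pi> (take n u)) (h \<otimes> \<pi> (take n v)) \<le> c1"
    if "h \<in> carrier G" "x \<in> insert [] {[a] | a. a \<in> A}" "u \<in> L" "v \<in> L"
      "h \<otimes> \<pi> x \<otimes> \<pi> u = h \<otimes> \<pi> v" for h x u v n
  proof -
    have A: "u \<in> lists A" "v \<in> lists A" "x \<in> lists A" using that lang_words by auto
    have "h \<otimes> \<pi> v = h \<otimes> \<pi> (x @ u)"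
      using that(1,5) A by (simp add: m_assoc)
    then have "\<pi> v = \<pi> (x @ u)"
      using that(1) A by simp
    then have "d (\<pi> x \<otimes> \<pi> (take n u)) (\<pi> (take n v)) \<le> c1" using c1 that by blast
    then show ?thesis
      using dist_translate_le[of h "\<pi> x \<otimes> \<pi> (take n u)" "\<pi> (take n v)"] that(1) A
      by (simp add: m_assoc)
  qed
  show ?thesis
  proof (induction K)
    case 0
    have "d (g \<otimes> \<pi> (take n u)) (h \<otimes> \<pi> (take n v)) \<le> c1"
      if "g \<in> carrier G" "h \<in> carrier G" "u \<in> L" "v \<in> L" "d g h \<le> 0" "g \<otimes> \<pi> u = h \<otimes> \<pi> v" for g h u v n
    proof -
      have "g = h" using relpow_dist[of g h] that by auto
      then show ?thesis using step[of h "[]" u v n] that by simp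
    qed
    then show ?case by blast
  next
    case (Suc K)
    then obtain c where c: "\<And>g h u v n. g \<in> carrier G \<Longrightarrow> h \<in> carrier G \<Longrightarrow> u \<in> L \<Longrightarrow> v \<in> L \<Longrightarrow>
        d g h \<le> K \<Longrightarrow> g \<otimes> \<pi> u = h \<otimes> \<pi> v \<Longrightarrow> d (g \<otimes> \<pi> (take n u)) (h \<otimes> \<pi> (take n v)) \<le> c"
      by blast
    have "d (g \<otimes> \<pi> (take n u)) (h \<otimes> \<pi> (take n v)) \<le> c + c1"
      if gh: "g \<in> carrier G" "h \<in> carrier G" "u \<in> L" "v \<in> L" "d g h \<le> Suc K"
        "g \<otimes> \<pi> u = h \<otimes> \<pi> v" for g h u v n
    proof -
      have A: "u \<in> lists A" "v \<in> lists A" using gh lang_words by auto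
      obtain k where k: "k \<in> carrier G" "d g k \<le> K" "k = h \<or> (k, h) \<in> cayley_adj G letters"
        using dist_SucE[OF _ _ gh(5)] gh by blast
      obtain w where w: "w \<in> L" "\<pi> w = inv k \<otimes> (h \<otimes> \<pi> v)"
        using lang_surj[of "inv k \<otimes> (h \<otimes> \<pi> v)"] k(1) gh(2) A(2) by auto
      have wA: "w \<in> lists A" using w lang_words by auto
      have kw: "k \<otimes> \<pi> w = h \<otimes> \<pi> v"
        unfolding w(2) using k(1) gh A by (simp add: m_assoc[symmetric])
      from k(3) consider "k = h" | a where "a \<in> A" "h = k \<otimes> \<pi> [a]"
        | a where "a \<in> A" "k = h \<otimes> \<pi> [a]"
        unfolding cayley_adj_def by blast
      then have "d (k \<otimes> \<pi> (take n w)) (h \<otimes> \<pi> (take n v)) \<le> c1"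
      proof cases
        case 1
        then show ?thesis using step[of h "[]" w v n] w(1) gh kw by simp
      next
        case 2
        then have "d (h \<otimes> \<pi> (take n v)) (k \<otimes> \<pi> (take n w)) \<le> c1"
          using step[of k "[a]" v w n] w(1) gh kw k(1) by simp
        then show ?thesis
          using dist_commute[of "h \<otimes> \<pi> (take n v)" "k \<otimes> \<pi> (take n w)"] A wA gh k(1)
          by simp
      next
        case 3
        then show ?thesis using step[of h "[a]" w v n] w(1) gh kw by simp
      qed
      moreover have "d (g \<otimes> \<pi> (take n u)) (k \<otimes> \<pi> (take n w)) \<le> c"
        using c[OF gh(1) k(1) gh(3) w(1) k(2)] kw gh(6) by simp
      ultimately show ?thesis
        using dist_triangle[of "g \<otimes> \<pi> (take n u)" "k \<otimes> \<pi> (take n w)" "h \<otimes> \<pi> (take n v)"]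
          A wA gh k(1) by simp
    qed
    then show ?case by blast
  qed
qed

end

section \<open>Length control by a departure function\<close>

text \<open>When \<open>u\<close> has ended, \<open>v\<close> is close to \<open>\<pi> u\<close> and therefore to its own endpoint \<open>\<pi> v\<close>; the departure
  function bounds the time that \<open>v\<close> can still take to get there.\<close>

lemma (in automatic_group_structure) length_diff_bounded:
  assumes "departure_function G A \<pi> L D"
  shows "\<exists>c. \<forall>u\<in>L. \<forall>v\<in>L. d (\<pi> u) (\<pi> v) \<le> K \<longrightarrow> length v \<le> length u + c"
proof -
  obtain c where c: "\<And>u v n. u \<in> L \<Longrightarrow> v \<in> L \<Longrightarrow> d (\<pi> u) (\<pi> v) \<le> K \<Longrightarrow>
      d (\<pi> (take n u)) (\<pi> (take n v)) \<le> c"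
    using right_fellow_travel by blast
  have dep: "r < real (d (\<pi> (take s w)) (\<pi> (take (s + t) w)))"
    if "w \<in> L" "0 \<le> r" "D r \<le> real t" "s + t \<le> length w" for w r s t
    using assms that unfolding departure_function_def alphabet_dist_def by blast
  define r where "r = real (c + K)"
  have "length v \<le> length u + nat \<lceil>D r\<rceil>"
    if uv: "u \<in> L" "v \<in> L" "d (\<pi> u) (\<pi> v) \<le> K" for u v
  proof (rule ccontr)
    assume "\<not> length v \<le> length u + nat \<lceil>D r\<rceil>"
    then have t: "length v = length u + (length v - length u)" "D r \<le> real (length v - length u)"
      by linarith+
    have A: "u \<in> lists A" "v \<in> lists A" using uv lang_words by auto
    have "0 \<le> r" by (simp add: r_def)
    then have "r < real (d (\<pi> (take (length u) v)) (\<pi> (take (length u + (length v - length u)) v)))"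
      using dep[OF uv(2) _ t(2), of "length u"] t(1) by linarith
    then have "c + K < d (\<pi> (take (length u) v)) (\<pi> v)"
      using t(1) unfolding r_def by simp
    moreover have "d (\<pi> u) (\<pi> (take (length u) v)) \<le> c"
      using c[OF uv, of "length u"] by simp
    ultimately show False
      using dist_triangle[of "\<pi> (take (length u) v)" "\<pi> u" "\<pi> v"]
        dist_commute[of "\<pi> (take (length u) v)" "\<pi> u"] A uv(3)
      by simp
  qed
  then show ?thesis by blast
qed

text \<open>It suffices that the path \<open>u\<^sub>3\<close> passes near \<open>\<pi> u\<^sub>1\<close> at some time \<open>m\<close>. The two halves of \<open>u\<^sub>3\<close> are
  compared with \<open>u\<^sub>1\<close> and \<open>u\<^sub>2\<close> after extending them to words of \<open>L\<close>, and the difference between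
  \<open>m\<close> and \<open>length u\<^sub>1\<close> is bounded by the departure function.\<close>

lemma (in biautomatic_group_structure) concatenation_fellow_travels:
  assumes "departure_function G A \<pi> L D"
  shows "\<exists>q. \<forall>u\<^sub>1\<in>L. \<forall>u\<^sub>2\<in>L. \<forall>u\<^sub>3\<in>L. \<forall>m\<le>length u\<^sub>3.
    d (\<pi> u\<^sub>1) (\<pi> (take m u\<^sub>3)) \<le> K \<and> \<pi> (u\<^sub>1 @ u\<^sub>2) = \<pi> u\<^sub>3 \<longrightarrow>
    (\<forall>n. d (\<pi> (take n (u\<^sub>1 @ u\<^sub>2))) (\<pi> (take n u\<^sub>3)) \<le> q)"
proof -
  obtain c1 where c1: "\<And>u n. u \<in> L \<Longrightarrow> \<exists>z\<in>lists A. length z \<le> c1 \<and> take n u @ z \<in> L"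
    using prefix_completion by blast
  obtain c2 where c2: "\<And>u n. u \<in> L \<Longrightarrow> \<exists>z\<in>lists A. length z \<le> c2 \<and> z @ drop n u \<in> L"
    using suffix_completion by blast
  obtain e where e: "\<And>u v. u \<in> L \<Longrightarrow> v \<in> L \<Longrightarrow> d (\<pi> u) (\<pi> v) \<le> K + c1 \<Longrightarrow> length v \<le> length u + e"
    using length_diff_bounded[OF assms] by blast
  obtain f where f: "\<And>u v n. u \<in> L \<Longrightarrow> v \<in> L \<Longrightarrow> d (\<pi> u) (\<pi> v) \<le> K + c1 \<Longrightarrow>
      d (\<pi> (take n u)) (\<pi> (take n v)) \<le> f"
    using right_fellow_travel by blast
  obtain l where l: "\<And>g h u v n. g \<in> carrier G \<Longrightarrow> h \<in> carrier G \<Longrightarrow> u \<in> L \<Longrightarrow> v \<in> L \<Longrightarrow>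
      d g h \<le> K + c2 \<Longrightarrow> g \<otimes> \<pi> u = h \<otimes> \<pi> v \<Longrightarrow> d (g \<otimes> \<pi> (take n u)) (h \<otimes> \<pi> (take n v)) \<le> l"
    using left_fellow_travel[of "K + c2"] by blast
  have "d (\<pi> (take n (u\<^sub>1 @ u\<^sub>2))) (\<pi> (take n u\<^sub>3)) \<le> f + l + c1 + c1 + c2 + e + e"
    if L: "u\<^sub>1 \<in> L" "u\<^sub>2 \<in> L" "u\<^sub>3 \<in> L" and m: "m \<le> length u\<^sub>3"
      and close: "d (\<pi> u\<^sub>1) (\<pi> (take m u\<^sub>3)) \<le> K" and eq: "\<pi> (u\<^sub>1 @ u\<^sub>2) = \<pi> u\<^sub>3"
    for u\<^sub>1 u\<^sub>2 u\<^sub>3 m n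
  proof -
    define a where "a = take m u\<^sub>3"
    define b where "b = drop m u\<^sub>3"
    have u3: "u\<^sub>3 = a @ b" and la: "length a = m" using m by (simp_all add: a_def b_def)
    obtain z where z: "z \<in> lists A" "length z \<le> c1" "a @ z \<in> L" using c1[OF L(3)] a_def by blast
    obtain y where y: "y \<in> lists A" "length y \<le> c2" "y @ b \<in> L" using c2[OF L(3)] b_def by blast
    have A: "u\<^sub>1 \<in> lists A" "u\<^sub>2 \<in> lists A" "u\<^sub>3 \<in> lists A" using L lang_words by auto
    have A': "a \<in> lists A" "b \<in> lists A" using A(3) unfolding u3 by auto
    have az: "d (\<pi> u\<^sub>1) (\<pi> (a @ z)) \<le> K + c1"
      using dist_triangle[of "\<pi> u\<^sub>1" "\<pi> a" "\<pi> (a @ z)"] dist_eval_le[of "\<pi> a" z] close z A A'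
      unfolding a_def[symmetric] by simp
    then have az': "d (\<pi> (a @ z)) (\<pi> u\<^sub>1) \<le> K + c1"
      using dist_commute[of "\<pi> u\<^sub>1" "\<pi> (a @ z)"] A A' z by simp
    have len1: "m \<le> length u\<^sub>1 + e" using e[OF L(1) z(3) az] la by simp
    have len2: "length u\<^sub>1 \<le> m + c1 + e" using e[OF z(3) L(1) az'] la z(2) by simp
    \<comment> \<open>Before time \<open>length u\<^sub>1\<close> the comparison passes through \<open>a @ z\<close>, which agrees with \<open>u\<^sub>3\<close> up to
        time \<open>m\<close>; if \<open>n\<close> exceeds \<open>m\<close>, it does so by at most \<open>c1 + e\<close>, whence the doubled constants.\<close>
    show ?thesis
    proof (cases "n \<le> length u\<^sub>1")
      case True
      have "d (\<pi> (take n u\<^sub>1)) (\<pi> (take n (a @ z))) \<le> f" by (rule f[OF L(1) z(3) az])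
      moreover have "d (\<pi> (take n (a @ z))) (\<pi> (take (min n m) (a @ z))) \<le> c1 + e"
        using dist_take_take_le[OF lang_words[OF z(3)], of n "min n m"] len2 True by linarith
      moreover have "take (min n m) (a @ z) = take (min n m) u\<^sub>3" using la u3 by simp
      moreover have "take n (u\<^sub>1 @ u\<^sub>2) = take n u\<^sub>1" using True by simp
      moreover have "d (\<pi> (take (min n m) u\<^sub>3)) (\<pi> (take n u\<^sub>3)) \<le> c1 + e"
        using dist_take_take_le[OF A(3), of "min n m" n] len2 True by simp
      ultimately show ?thesis
        using dist_triangle[of "\<pi> (take n u\<^sub>1)" "\<pi> (take n (a @ z))" "\<pi> (take n u\<^sub>3)"]
          dist_triangle[of "\<pi> (take n (a @ z))" "\<pi> (take (min n m) u\<^sub>3)" "\<pi> (take n u\<^sub>3)"]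
          True A lang_words[OF z(3)] eval_take_carrier
        by (simp del: take_append)
    next
      case False
      define j where "j = n - length u\<^sub>1"
      have n: "n = length u\<^sub>1 + j" using False by (simp add: j_def)
      \<comment> \<open>The word \<open>y @ b\<close> read from \<open>g\<close> passes through \<open>\<pi> a\<close> at time \<open>length y\<close> and then follows \<open>u\<^sub>3\<close>.\<close>
      define g where "g = \<pi> a \<otimes> inv (\<pi> y)"
      have g: "g \<in> carrier G" "g \<otimes> \<pi> y = \<pi> a"
        using A' y(1) by (simp_all add: g_def m_assoc)
      have "d (\<pi> u\<^sub>1) g \<le> d (\<pi> u\<^sub>1) (\<pi> a) + d g (\<pi> a)"
        using dist_triangle[of "\<pi> u\<^sub>1" "\<pi> a" g] dist_commute[of g "\<pi> a"] A A' g(1)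
        by simp
      then have "d (\<pi> u\<^sub>1) g \<le> K + c2"
        using dist_eval_le[OF g(1) y(1)] y(2) close g(2) unfolding a_def[symmetric] by simp
      moreover have "\<pi> u\<^sub>1 \<otimes> \<pi> u\<^sub>2 = g \<otimes> \<pi> (y @ b)"
        using eq A A' y(1) g unfolding u3 by (simp add: m_assoc[symmetric])
      ultimately have "d (\<pi> u\<^sub>1 \<otimes> \<pi> (take j u\<^sub>2)) (g \<otimes> \<pi> (take j (y @ b))) \<le> l"
        using l[OF _ g(1) L(2) y(3)] A(1) by simp
      moreover have "\<pi> (take n (u\<^sub>1 @ u\<^sub>2)) = \<pi> u\<^sub>1 \<otimes> \<pi> (take j u\<^sub>2)"
        using A take_in_lists by (simp add: n)
      moreover have "d (g \<otimes> \<pi> (take j (y @ b))) (g \<otimes> \<pi> (take (length y + j) (y @ b))) \<le> c2"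
        using dist_translate_le[OF g(1), of "\<pi> (take j (y @ b))" "\<pi> (take (length y + j) (y @ b))"]
          dist_take_take_le[OF lang_words[OF y(3)], of j "length y + j"] y(2)
          eval_take_carrier[OF lang_words[OF y(3)]]
        by (simp del: take_append)
      moreover have "g \<otimes> \<pi> (take (length y + j) (y @ b)) = \<pi> (take (m + j) u\<^sub>3)"
        using g A' y(1) take_in_lists la unfolding u3
        by (simp add: m_assoc[symmetric])
      moreover have "d (\<pi> (take (m + j) u\<^sub>3)) (\<pi> (take n u\<^sub>3)) \<le> c1 + e"
        using dist_take_take_le[OF A(3), of "m + j" n] len1 len2 by (simp add: n)
      ultimately show ?thesis
        using dist_triangle[of "\<pi> u\<^sub>1 \<otimes> \<pi> (take j u\<^sub>2)" "g \<otimes> \<pi> (take j (y @ b))" "\<pi> (take n u\<^sub>3)"]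
          dist_triangle[of "g \<otimes> \<pi> (take j (y @ b))" "\<pi> (take (m + j) u\<^sub>3)" "\<pi> (take n u\<^sub>3)"]
          A g(1) eval_take_carrier[OF lang_words[OF y(3)]]
        by (simp del: take_append)
    qed
  qed
  then show ?thesis by blast
qed

section \<open>Bounded reduction implies its fellow travelling form\<close>

text \<open>The bound on a Hausdorff distance, which is an extended real built from suprema and infima, read
  as a statement about individual vertices.\<close>

lemma BRP_path_near:
  assumes "alphabet_group G A \<pi>\<^sub>1" "L\<^sub>1 \<subseteq> lists A" "alphabet_group G B \<pi>\<^sub>2" "L\<^sub>2 \<subseteq> lists B"
    and "\<phi> \<in> hom G G" "BRP G S \<pi>\<^sub>1 \<pi>\<^sub>2 \<phi> L\<^sub>1 L\<^sub>2"
  shows "\<exists>N. \<forall>u\<in>L\<^sub>1. \<forall>v\<in>L\<^sub>2. \<pi>\<^sub>2 v = \<phi> (\<pi>\<^sub>1 u) \<longrightarrow>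
    (\<forall>n. \<exists>m\<le>length v. word_dist G S (\<phi> (\<pi>\<^sub>1 (take n u))) (\<pi>\<^sub>2 (take m v)) \<le> N)"
proof -
  interpret A: alphabet_group G A \<pi>\<^sub>1 by fact
  interpret B: alphabet_group G B \<pi>\<^sub>2 by fact
  have \<phi>1: "\<phi> \<one>\<^bsub>G\<^esub> = \<one>\<^bsub>G\<^esub>" using hom_one[OF assms(5) A.is_group A.is_group] .
  obtain N :: real where N: "\<And>x u v. x \<in> carrier G \<Longrightarrow> u \<in> L\<^sub>1 \<Longrightarrow> v \<in> L\<^sub>2 \<Longrightarrow> \<pi>\<^sub>2 v = \<phi> (\<pi>\<^sub>1 u) \<Longrightarrow>
      hausdorff_dist (word_dist G S) (\<phi> ` path_image G \<pi>\<^sub>1 x u) (path_image G \<pi>\<^sub>2 (\<phi> x) v) \<le> ereal N"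
    using assms(6) unfolding BRP_def by blast
  have "\<exists>m\<le>length v. word_dist G S (\<phi> (\<pi>\<^sub>1 (take n u))) (\<pi>\<^sub>2 (take m v)) \<le> nat \<lceil>N + 1\<rceil>"
    if uv: "u \<in> L\<^sub>1" "v \<in> L\<^sub>2" "\<pi>\<^sub>2 v = \<phi> (\<pi>\<^sub>1 u)" for u v n
  proof -
    let ?Y = "path_image G \<pi>\<^sub>2 \<one>\<^bsub>G\<^esub> v"
    have uA: "u \<in> lists A" and vB: "v \<in> lists B" using uv assms by auto
    have "take n u = take (min n (length u)) u" by (simp add: min_def)
    then have mem: "\<phi> (\<pi>\<^sub>1 (take n u)) \<in> \<phi> ` path_image G \<pi>\<^sub>1 \<one>\<^bsub>G\<^esub> u"
      unfolding path_image_def using A.eval_take_carrier[OF uA]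
      by (intro imageI image_eqI[of _ _ "min n (length u)"]) auto
    have "(INF y\<in>?Y. ereal (real (word_dist G S (\<phi> (\<pi>\<^sub>1 (take n u))) y)))
        \<le> (SUP x\<in>\<phi> ` path_image G \<pi>\<^sub>1 \<one>\<^bsub>G\<^esub> u. INF y\<in>?Y. ereal (real (word_dist G S x y)))"
      by (rule SUP_upper[OF mem])
    also have "\<dots> \<le> hausdorff_dist (word_dist G S) (\<phi> ` path_image G \<pi>\<^sub>1 \<one>\<^bsub>G\<^esub> u) ?Y"
      unfolding hausdorff_dist_def by (rule max.cobounded1)
    also have "\<dots> \<le> ereal N"
      using N[OF A.one_closed uv] unfolding \<phi>1 .
    \<comment> \<open>The strict bound turns the infimum into an actual vertex of the path.\<close>
    also have "\<dots> < ereal (N + 1)" by simp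
    finally obtain y where "y \<in> ?Y" "real (word_dist G S (\<phi> (\<pi>\<^sub>1 (take n u))) y) < N + 1"
      by (auto simp: INF_less_iff)
    moreover from this(1) obtain m where "m \<le> length v" "y = \<pi>\<^sub>2 (take m v)"
      unfolding path_image_def using B.eval_take_carrier[OF vB] by auto
    ultimately show ?thesis by (intro exI[of _ m] conjI) (simp_all, linarith)
  qed
  then show ?thesis by blast
qed

theorem proposition4p11:
  fixes G :: "('g, 'm) monoid_scheme"
    and A :: "'a set" and \<pi>\<^sub>1 :: "'a list \<Rightarrow> 'g" and L\<^sub>1 :: "'a list set"
    and B :: "'b set" and \<pi>\<^sub>2 :: "'b list \<Rightarrow> 'g" and L\<^sub>2 :: "'b list set"
    and \<phi> :: "'g \<Rightarrow> 'g" and S :: "'g set"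
  assumes "biautomatic_group G"
    and "finite A" "surj_monoid_hom A \<pi>\<^sub>1 G" "automatic_structure G A \<pi>\<^sub>1 L\<^sub>1"
    and "finite B" "surj_monoid_hom B \<pi>\<^sub>2 G" "biautomatic_structure G B \<pi>\<^sub>2 L\<^sub>2"
    and "\<exists>D. departure_function G B \<pi>\<^sub>2 L\<^sub>2 D"
    and "\<phi> \<in> hom G G"
    and "finite S" "S \<subseteq> carrier G" "generate G S = carrier G"
    and "BRP G S \<pi>\<^sub>1 \<pi>\<^sub>2 \<phi> L\<^sub>1 L\<^sub>2"
  shows "FT_BRP G A \<pi>\<^sub>1 B \<pi>\<^sub>2 \<phi> L\<^sub>1 L\<^sub>2"
proof -
  have G: "group G" using assms(1) unfolding biautomatic_group_def by blast
  then interpret G: group G .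
  interpret A: automatic_group_structure G A \<pi>\<^sub>1 L\<^sub>1
    by unfold_locales (rule assms)+
  interpret B: biautomatic_group_structure G B \<pi>\<^sub>2 L\<^sub>2
    by unfold_locales (rule assms)+
  interpret S: generated_group G S
    by unfold_locales (rule assms)+
  have \<phi>: "\<And>g. g \<in> carrier G \<Longrightarrow> \<phi> g \<in> carrier G"
    "\<And>g h. g \<in> carrier G \<Longrightarrow> h \<in> carrier G \<Longrightarrow> \<phi> (g \<otimes>\<^bsub>G\<^esub> h) = \<phi> g \<otimes>\<^bsub>G\<^esub> \<phi> h"
    using assms(9) by (auto simp: hom_def)
  obtain D where D: "departure_function G B \<pi>\<^sub>2 L\<^sub>2 D" using assms(8) by blast
  obtain C where C: "\<And>g h. g \<in> carrier G \<Longrightarrow> h \<in> carrier G \<Longrightarrow> B.d (\<phi> g) (\<phi> h) \<le> C * A.d g h"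
    using word_dist_hom_lipschitz[OF A.generated_group_axioms _ B.generated_group_axioms assms(9)]
      assms(2) by blast
  have "(\<lambda>g. g) \<in> hom G G" by (simp add: hom_def)
  then obtain C' where C': "\<And>g h. g \<in> carrier G \<Longrightarrow> h \<in> carrier G \<Longrightarrow> B.d g h \<le> C' * S.d g h"
    using word_dist_hom_lipschitz[OF S.generated_group_axioms assms(10) B.generated_group_axioms]
    by blast
  obtain N where N: "\<And>u v n. u \<in> L\<^sub>1 \<Longrightarrow> v \<in> L\<^sub>2 \<Longrightarrow> \<pi>\<^sub>2 v = \<phi> (\<pi>\<^sub>1 u) \<Longrightarrow>
      \<exists>m\<le>length v. S.d (\<phi> (\<pi>\<^sub>1 (take n u))) (\<pi>\<^sub>2 (take m v)) \<le> N"
    using BRP_path_near[OF A.alphabet_group_axioms _ B.alphabet_group_axioms _ assms(9,13)]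
      A.lang_words B.lang_words by blast
  show ?thesis
    unfolding FT_BRP_def
  proof (intro allI impI)
    fix p :: real assume "0 \<le> p"
    define P where "P = nat \<lfloor>p\<rfloor>"
    obtain q where q: "\<And>u1 u2 u3 m n. u1 \<in> L\<^sub>2 \<Longrightarrow> u2 \<in> L\<^sub>2 \<Longrightarrow> u3 \<in> L\<^sub>2 \<Longrightarrow> m \<le> length u3 \<Longrightarrow>
        B.d (\<pi>\<^sub>2 u1) (\<pi>\<^sub>2 (take m u3)) \<le> C * P + C' * N \<Longrightarrow> \<pi>\<^sub>2 (u1 @ u2) = \<pi>\<^sub>2 u3 \<Longrightarrow>
        B.d (\<pi>\<^sub>2 (take n (u1 @ u2))) (\<pi>\<^sub>2 (take n u3)) \<le> q"
      using B.concatenation_fellow_travels[OF D, of "C * P + C' * N"] by blast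
    have "MFT G B \<pi>\<^sub>2 (real q) (u1' @ u2') u3'"
      if L1: "u1 \<in> L\<^sub>1" "u2 \<in> L\<^sub>1" "u3 \<in> L\<^sub>1" and L2: "u1' \<in> L\<^sub>2" "u2' \<in> L\<^sub>2" "u3' \<in> L\<^sub>2"
        and im: "\<pi>\<^sub>2 u1' = \<phi> (\<pi>\<^sub>1 u1)" "\<pi>\<^sub>2 u2' = \<phi> (\<pi>\<^sub>1 u2)" "\<pi>\<^sub>2 u3' = \<phi> (\<pi>\<^sub>1 u3)"
        and mft: "MFT G A \<pi>\<^sub>1 p (u1 @ u2) u3"
      for u1 u2 u3 u1' u2' u3'
    proof -
      have A: "u1 \<in> lists A" "u2 \<in> lists A" "u3 \<in> lists A" using L1 A.lang_words by auto
      have B: "u1' \<in> lists B" "u2' \<in> lists B" "u3' \<in> lists B" using L2 B.lang_words by auto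
      let ?h = "\<pi>\<^sub>1 (take (length u1) u3)"
      have "real (A.d (\<pi>\<^sub>1 (take (length u1) (u1 @ u2))) ?h) \<le> p"
        using mft unfolding MFT_def fellow_travel_def alphabet_dist_def by blast
      then have "A.d (\<pi>\<^sub>1 u1) ?h \<le> P" unfolding P_def by (simp add: le_nat_floor)
      then have 1: "B.d (\<phi> (\<pi>\<^sub>1 u1)) (\<phi> ?h) \<le> C * P"
        using C[of "\<pi>\<^sub>1 u1" ?h] A by (meson A.eval_carrier A.eval_take_carrier le_trans mult_le_mono2)
      obtain m where m: "m \<le> length u3'" "S.d (\<phi> ?h) (\<pi>\<^sub>2 (take m u3')) \<le> N"
        using N[OF L1(3) L2(3) im(3)] by blast
      then have "B.d (\<phi> ?h) (\<pi>\<^sub>2 (take m u3')) \<le> C' * N"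
        using C'[of "\<phi> ?h" "\<pi>\<^sub>2 (take m u3')"] A B \<phi>(1)
        by (meson A.eval_take_carrier B.eval_take_carrier le_trans mult_le_mono2)
      with 1 have near: "B.d (\<pi>\<^sub>2 u1') (\<pi>\<^sub>2 (take m u3')) \<le> C * P + C' * N"
        using B.dist_triangle[of "\<phi> (\<pi>\<^sub>1 u1)" "\<phi> ?h" "\<pi>\<^sub>2 (take m u3')"] A B \<phi>(1) im(1)
        by simp
      have "\<pi>\<^sub>1 (u1 @ u2) = \<pi>\<^sub>1 u3" using mft unfolding MFT_def by blast
      then have eq: "\<pi>\<^sub>2 (u1' @ u2') = \<pi>\<^sub>2 u3'"
        using A B im \<phi>(2)[of "\<pi>\<^sub>1 u1" "\<pi>\<^sub>1 u2"] by simp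
      show ?thesis
        unfolding MFT_def fellow_travel_def alphabet_dist_def
        using q[OF L2 m(1) near eq] eq by simp
    qed
    then show "\<exists>q\<ge>0. \<forall>u\<^sub>1\<in>L\<^sub>1. \<forall>u\<^sub>2\<in>L\<^sub>1. \<forall>u\<^sub>3\<in>L\<^sub>1. \<forall>u\<^sub>1'\<in>L\<^sub>2. \<forall>u\<^sub>2'\<in>L\<^sub>2. \<forall>u\<^sub>3'\<in>L\<^sub>2.
        \<pi>\<^sub>2 u\<^sub>1' = \<phi> (\<pi>\<^sub>1 u\<^sub>1) \<and> \<pi>\<^sub>2 u\<^sub>2' = \<phi> (\<pi>\<^sub>1 u\<^sub>2) \<and> \<pi>\<^sub>2 u\<^sub>3' = \<phi> (\<pi>\<^sub>1 u\<^sub>3)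
        \<and> MFT G A \<pi>\<^sub>1 p (u\<^sub>1 @ u\<^sub>2) u\<^sub>3
        \<longrightarrow> MFT G B \<pi>\<^sub>2 q (u\<^sub>1' @ u\<^sub>2') u\<^sub>3'"
      by (intro exI[of _ "real q"]) auto
  qed
qed

end
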